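(* Let $\mathcal{C}$ be a finite candidate pool of tetrahedra on the vertex set $\{1,\dots,n\}$, let $\mathcal{T}_0\subseteq\mathcal{C}$ be an initial active set, and let $(\Delta_t^-,\Delta_t^+)_{t=0}^{F-1}$ be a finite edit stream with $\Delta_t^-\subseteq\mathcal{T}_t$, $\Delta_t^+\subseteq\mathcal{C}\setminus\mathcal{T}_t$ and $\mathcal{T}_{t+1}=(\mathcal{T}_t\setminus\Delta_t^-)\cup\Delta_t^+$. Fix $\varepsilon>0$. Let $\hat A_t$ denote the matrix maintained by the streaming update procedure described in the context, initialized from $\mathcal{T}_0$ and run on this edit stream, where the edited tetrahedra within each frame and the edges within each tetrahedron are processed in any order. Then for every $t\in\{0,1,\dots,F\}$ the maintained matrix equals the matrix obtained by rebuilding from scratch on the current active tetrahedron set: $$\hat A_t = A(\mathcal{T}_t).$$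
   Context: A tetrahedron $\tau$ has four distinct vertices in $\{1,\dots,n\}$; $E(\tau)$ denotes the set of its six undirected edges. Rebuilt matrix. For an active set $\mathcal{T}\subseteq\mathcal{C}$ define, for each undirected edge $\{u,v\}$ with $u\ne v$, the edge multiplicity $c_{\mathcal{T}}(u,v)=\sum_{\tau\in\mathcal{T}}\mathbf{1}[\{u,v\}\in E(\tau)]$ and the binary activity $a_{\mathcal{T}}(u,v)=\mathbf{1}[c_{\mathcal{T}}(u,v)>0]$. Let $L(\mathcal{T})\in\mathbb{R}^{n\times n}$ have entries $L(\mathcal{T})(u,v)=-a_{\mathcal{T}}(u,v)$ for $u\neq v$ and $L(\mathcal{T})(u,u)=\sum_{w\neq u}a_{\mathcal{T}}(u,w)$, and set $A(\mathcal{T})=L(\mathcal{T})+\varepsilon I$. Streaming update procedure. The maintained state consists of an integer $\hat c(e)$ for each undirected edge $e$ and a matrix $\hat A\in\mathbb{R}^{n\times n}$. Initially $\hat c=c_{\mathcal{T}_0}$ and $\hat A=\hat A_0=A(\mathcal{T}_0)$. On frame $t$, for each $\tau\in\Delta_t^-\cup\Delta_t^+$ and each edge $e=\{u,v\}\in E(\tau)$, one at a time: (i) replace $\hat c(e)$ by $\hat c(e)+\mathbf{1}[\tau\in\Delta_t^+]-\mathbf{1}[\tau\in\Delta_t^-]$; (ii) if this changes $\hat c(e)$ from $0$ to a positive value, insert the off-diagonal entries by setting $\hat A(u,v)=\hat A(v,u)=-1$, and increase each of $\hat A(u,u)$ and $\hat A(v,v)$ by $1$; (iii) if this changes $\hat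 c(e)$ from a positive value to $0$, remove the off-diagonal entries by setting $\hat A(u,v)=\hat A(v,u)=0$, and decrease each of $\hat A(u,u)$ and $\hat A(v,v)$ by $1$; (iv) otherwise leave $\hat A$ unchanged. $\hat A_{t+1}$ denotes the value of $\hat A$ after all edits of frame $t$ have been processed. *)

theory Defs
  imports "HOL-Analysis.Analysis" "HOL-Combinatorics.Multiset_Permutations"
begin

(* The vertex set {1,...,n} is a finite index type 'n with n = CARD('n).  A tetrahedron is
   its set of vertices, and an undirected edge {u,v} with u \<noteq> v is a two-element set. *)

definition tetrahedron :: "'n set \<Rightarrow> bool" where
  "tetrahedron \<tau> \<longleftrightarrow> card \<tau> = 4"

definition edges :: "'n set \<Rightarrow> 'n set set" where
  "edges \<tau> = {{u, v} | u v. u \<in> \<tau> \<and> v \<in> \<tau> \<and> u \<noteq> v}"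

definition edge_mult :: "'n set set \<Rightarrow> 'n set \<Rightarrow> int" where
  "edge_mult T e = (\<Sum>\<tau>\<in>T. of_bool (e \<in> edges \<tau>))"

definition activity :: "'n set set \<Rightarrow> 'n \<Rightarrow> 'n \<Rightarrow> real" where
  "activity T u v = of_bool (edge_mult T {u, v} > 0)"

definition laplacian :: "'n set set \<Rightarrow> real ^ 'n ^ 'n" where
  "laplacian T =
     (\<chi> u v. if u = v then \<Sum>w\<in>UNIV - {u}. activity T u w else - activity T u v)"

definition rebuilt_matrix :: "real \<Rightarrow> 'n set set \<Rightarrow> real ^ 'n ^ 'n" where
  "rebuilt_matrix \<epsilon> T = laplacian T + \<epsilon> *\<^sub>R mat 1"

definition insert_edge :: "'n set \<Rightarrow> real ^ 'n ^ 'n \<Rightarrow> real ^ 'n ^ 'n" where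
  "insert_edge e A =
     (\<chi> i j. if i \<noteq> j \<and> {i, j} = e then - 1
            else if i = j \<and> i \<in> e then A $ i $ j + 1
            else A $ i $ j)"

definition remove_edge :: "'n set \<Rightarrow> real ^ 'n ^ 'n \<Rightarrow> real ^ 'n ^ 'n" where
  "remove_edge e A =
     (\<chi> i j. if i \<noteq> j \<and> {i, j} = e then 0
            else if i = j \<and> i \<in> e then A $ i $ j - 1
            else A $ i $ j)"

(* The maintained counters and the maintained matrix.  Counters are indexed by all vertex
   sets, but only those of two-element sets are ever edited. *)
type_synonym 'n state = "('n set \<Rightarrow> int) \<times> (real ^ 'n ^ 'n)"

definition edit_edge ::
  "'n::finite set set \<Rightarrow> 'n set set \<Rightarrow> 'n set \<Rightarrow> 'n set \<Rightarrow> 'n state \<Rightarrow> 'n state" where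
  "edit_edge Dm Dp \<tau> e s =
     (let c = fst s; A = snd s;
          k = c e + of_bool (\<tau> \<in> Dp) - of_bool (\<tau> \<in> Dm)
      in (c(e := k),
          if c e = 0 \<and> k > 0 then insert_edge e A
          else if c e > 0 \<and> k = 0 then remove_edge e A
          else A))"

(* ts is the order in which the edited tetrahedra are visited, es \<tau> the order in which the
   edges of \<tau> are visited. *)
definition process_frame ::
  "'n::finite set set \<Rightarrow> 'n set set \<Rightarrow> 'n set list \<Rightarrow> ('n set \<Rightarrow> 'n set list) \<Rightarrow> 'n state \<Rightarrow> 'n state" where
  "process_frame Dm Dp ts es = fold (\<lambda>\<tau>. fold (edit_edge Dm Dp \<tau>) (es \<tau>)) ts"

primrec stream_state ::
  "real \<Rightarrow> 'n::finite set set \<Rightarrow> (nat \<Rightarrow> 'n set set) \<Rightarrow> (nat \<Rightarrow> 'n set set) \<Rightarrow>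
   (nat \<Rightarrow> 'n set list) \<Rightarrow> (nat \<Rightarrow> 'n set \<Rightarrow> 'n set list) \<Rightarrow> nat \<Rightarrow> 'n state" where
  "stream_state \<epsilon> T0 Dm Dp ts es 0 = (edge_mult T0, rebuilt_matrix \<epsilon> T0)"
| "stream_state \<epsilon> T0 Dm Dp ts es (Suc t) =
     process_frame (Dm t) (Dp t) (ts t) (es t) (stream_state \<epsilon> T0 Dm Dp ts es t)"

definition maintained_matrix ::
  "real \<Rightarrow> 'n::finite set set \<Rightarrow> (nat \<Rightarrow> 'n set set) \<Rightarrow> (nat \<Rightarrow> 'n set set) \<Rightarrow>
   (nat \<Rightarrow> 'n set list) \<Rightarrow> (nat \<Rightarrow> 'n set \<Rightarrow> 'n set list) \<Rightarrow> nat \<Rightarrow> real ^ 'n ^ 'n" where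
  "maintained_matrix \<epsilon> T0 Dm Dp ts es t = snd (stream_state \<epsilon> T0 Dm Dp ts es t)"

end

(* After each edited tetrahedron the state is that of an intermediate active set: the tetrahedra
   visited so far have been removed or added, the others not yet.  While the edges of a tetrahedron
   are visited, every counter is the multiplicity of its edge before or after that tetrahedron is
   edited.  Hence no counter ever becomes negative, every change of activity is a transition between
   0 and a positive value, and the matrix always is the function of the counters that rebuilding
   computes. *)
theory Submission imports Defs begin

text \<open>Arbitrary counters are allowed because, with a tetrahedron only partly processed, they
  need not be the multiplicities of any set of tetrahedra.\<close>

definition counter_matrix :: "real \<Rightarrow> ('n set \<Rightarrow> int) \<Rightarrow> real ^ 'n ^ 'n" where
  "counter_matrix \<epsilon> c =
     (\<chi> u v. if u = v then \<Sum>w\<in>UNIV - {u}. of_bool (c {u, w} > 0) else - of_bool (c {u, v} > 0))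
     + \<epsilon> *\<^sub>R mat 1"

lemma rebuilt_matrix_eq_counter_matrix:
  "rebuilt_matrix \<epsilon> T = counter_matrix \<epsilon> (edge_mult T)"
  by (simp add: rebuilt_matrix_def laplacian_def counter_matrix_def activity_def vec_eq_iff)

lemma counter_matrix_diag:
  "counter_matrix \<epsilon> c $ i $ i = (\<Sum>w\<in>UNIV - {i}. of_bool (c {i, w} > 0)) + \<epsilon>"
  by (simp add: counter_matrix_def mat_def)

lemma counter_matrix_offdiag:
  "i \<noteq> j \<Longrightarrow> counter_matrix \<epsilon> c $ i $ j = - of_bool (c {i, j} > 0)"
  by (simp add: counter_matrix_def mat_def)

text \<open>Entries depend on a counter only through its positivity. This settles the edits that
  leave the activity of an edge as it was.\<close>

lemma counter_matrix_cong:
  assumes "\<And>e. (c e > 0) = (d e > 0)"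
  shows "counter_matrix \<epsilon> c = counter_matrix \<epsilon> d"
  by (simp add: counter_matrix_def assms vec_eq_iff)

text \<open>If \<open>i\<close> is an endpoint of \<open>e\<close>, exactly one summand of row
  \<open>i\<close> belongs to \<open>e\<close>, and otherwise none does. The difference of
  activities covers insertion and removal at once.\<close>

lemma counter_matrix_diag_upd:
  fixes c :: "'n::finite set \<Rightarrow> int"
  assumes "card e = 2"
  shows "counter_matrix \<epsilon> (c(e := k)) $ i $ i =
    counter_matrix \<epsilon> c $ i $ i + (if i \<in> e then of_bool (k > 0) - of_bool (c e > 0) else 0)"
proof (cases "i \<in> e")
  case True
  with assms obtain j where e: "e = {i, j}" and "i \<noteq> j"
    by (auto simp: card_2_iff)
  have "(\<Sum>w\<in>UNIV - {i} - {j}. of_bool ((c(e := k)) {i, w} > 0)) =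
      (\<Sum>w\<in>UNIV - {i} - {j}. of_bool (c {i, w} > 0) :: real)"
    by (rule sum.cong) (auto simp: e doubleton_eq_iff)
  \<comment> \<open>The other endpoint \<open>j\<close> indexes the one summand that can change;
    \<open>f\<close> stands for the activities under the old and under the new counters.\<close>
  moreover have "sum f (UNIV - {i}) = f j + sum f (UNIV - {i} - {j})" for f :: "'n \<Rightarrow> real"
    by (rule sum.remove) (use \<open>i \<noteq> j\<close> in auto)
  ultimately show ?thesis
    unfolding counter_matrix_diag using e by (simp del: sum_of_bool_eq)
next
  case False
  then have "{i, w} \<noteq> e" for w
    by auto
  then show ?thesis
    using False by (simp add: counter_matrix_diag)
qed

lemma counter_matrix_insert_edge:
  fixes c :: "'n::finite set \<Rightarrow> int"
  assumes "card e = 2" "c e = 0" "k > 0"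
  shows "insert_edge e (counter_matrix \<epsilon> c) = counter_matrix \<epsilon> (c(e := k))"
proof -
  have "insert_edge e (counter_matrix \<epsilon> c) $ i $ j = counter_matrix \<epsilon> (c(e := k)) $ i $ j" for i j
  proof (cases "i = j")
    case True
    then show ?thesis
      unfolding True counter_matrix_diag_upd[OF assms(1)] by (simp add: insert_edge_def assms)
  next
    case False
    then show ?thesis
      by (cases "{i, j} = e") (simp_all add: insert_edge_def counter_matrix_offdiag assms)
  qed
  then show ?thesis
    by (simp add: vec_eq_iff)
qed

lemma counter_matrix_remove_edge:
  fixes c :: "'n::finite set \<Rightarrow> int"
  assumes "card e = 2" "c e > 0"
  shows "remove_edge e (counter_matrix \<epsilon> c) = counter_matrix \<epsilon> (c(e := 0))"
proof -
  have "remove_edge e (counter_matrix \<epsilon> c) $ i $ j = counter_matrix \<epsilon> (c(e := 0)) $ i $ j" for i j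
  proof (cases "i = j")
    case True
    then show ?thesis
      unfolding True counter_matrix_diag_upd[OF assms(1)] by (simp add: remove_edge_def assms)
  next
    case False
    then show ?thesis
      by (cases "{i, j} = e") (simp_all add: remove_edge_def counter_matrix_offdiag assms)
  qed
  then show ?thesis
    by (simp add: vec_eq_iff)
qed

text \<open>With nonnegative counters before and after, an edit goes from 0 to positive, from
  positive to 0, or keeps positivity. These are the branches (ii), (iii) and (iv) of the
  procedure.\<close>

lemma edit_edge_counter_matrix:
  fixes c :: "'n::finite set \<Rightarrow> int"
  defines "\<delta> \<equiv> \<lambda>Dm Dp \<tau>. of_bool (\<tau> \<in> Dp) - of_bool (\<tau> \<in> Dm)"
  assumes "card e = 2" "c e \<ge> 0" "c e + \<delta> Dm Dp \<tau> \<ge> 0"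
  shows "edit_edge Dm Dp \<tau> e (c, counter_matrix \<epsilon> c) =
    (c(e := c e + \<delta> Dm Dp \<tau>), counter_matrix \<epsilon> (c(e := c e + \<delta> Dm Dp \<tau>)))"
proof -
  define k where "k = c e + \<delta> Dm Dp \<tau>"
  have k: "c e + of_bool (\<tau> \<in> Dp) - of_bool (\<tau> \<in> Dm) = k"
    by (simp add: k_def \<delta>_def)
  have edit: "edit_edge Dm Dp \<tau> e (c, A) = (c(e := k),
      if c e = 0 \<and> k > 0 then insert_edge e A else if c e > 0 \<and> k = 0 then remove_edge e A else A)" for A
    unfolding edit_edge_def Let_def fst_conv snd_conv k ..
  have "k \<ge> 0"
    using assms by (simp add: k_def)
  then consider "c e = 0" "k > 0" | "c e > 0" "k = 0" | "(c e > 0) = (k > 0)"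
    using \<open>c e \<ge> 0\<close> by linarith
  then have "edit_edge Dm Dp \<tau> e (c, counter_matrix \<epsilon> c) = (c(e := k), counter_matrix \<epsilon> (c(e := k)))"
  proof cases
    case 1
    then show ?thesis
      by (simp add: edit counter_matrix_insert_edge \<open>card e = 2\<close>)
  next
    case 2
    then show ?thesis
      by (simp add: edit counter_matrix_remove_edge \<open>card e = 2\<close>)
  next
    case 3
    then have "counter_matrix \<epsilon> c = counter_matrix \<epsilon> (c(e := k))"
      by (intro counter_matrix_cong) auto
    with 3 show ?thesis
      unfolding edit by auto
  qed
  then show ?thesis
    by (simp only: k_def)
qed

text \<open>As no edge repeats, editing the head leaves the counters of the remaining edges
  untouched, so the sign conditions pass to the tail. The final counters \<open>d\<close> stay fixed
  in the induction while \<open>c\<close> varies: they differ only on edges still to be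
  visited.\<close>

lemma fold_edit_edge_counter_matrix:
  fixes c :: "'n::finite set \<Rightarrow> int"
  assumes "distinct xs"
    and "\<And>e. e \<in> set xs \<Longrightarrow> card e = 2"
    and "\<And>e. e \<in> set xs \<Longrightarrow> c e \<ge> 0"
    and "\<And>e. e \<in> set xs \<Longrightarrow> c e + of_bool (\<tau> \<in> Dp) - of_bool (\<tau> \<in> Dm) \<ge> 0"
    and "\<And>e. d e = c e + of_bool (e \<in> set xs) * (of_bool (\<tau> \<in> Dp) - of_bool (\<tau> \<in> Dm))"
  shows "fold (edit_edge Dm Dp \<tau>) xs (c, counter_matrix \<epsilon> c) = (d, counter_matrix \<epsilon> d)"
  using assms
proof (induction xs arbitrary: c)
  case Nil
  then have "d = c"
    by (simp add: fun_eq_iff)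
  then show ?case
    by simp
next
  case (Cons e xs)
  define c' where "c' = c(e := c e + (of_bool (\<tau> \<in> Dp) - of_bool (\<tau> \<in> Dm)))"
  have "edit_edge Dm Dp \<tau> e (c, counter_matrix \<epsilon> c) = (c', counter_matrix \<epsilon> c')"
    unfolding c'_def using Cons.prems(2-4)[of e] by (intro edit_edge_counter_matrix) auto
  moreover have "fold (edit_edge Dm Dp \<tau>) xs (c', counter_matrix \<epsilon> c') = (d, counter_matrix \<epsilon> d)"
    using Cons.prems by (intro Cons.IH) (auto simp: c'_def)
  ultimately show ?case
    by simp
qed

lemma card_edge: "e \<in> edges \<tau> \<Longrightarrow> card e = 2"
  by (auto simp: edges_def)

lemma edge_mult_nonneg: "edge_mult T e \<ge> 0"
  by (simp add: edge_mult_def sum_nonneg)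

lemma edge_mult_remove:
  fixes T :: "'n::finite set set"
  assumes "\<tau> \<in> T"
  shows "edge_mult T e = edge_mult (T - {\<tau>}) e + of_bool (e \<in> edges \<tau>)"
  unfolding edge_mult_def by (subst sum.remove[OF _ assms]) auto

lemma fold_edit_edge_rebuilt_matrix:
  fixes S :: "'n::finite set set"
  assumes "xs \<in> permutations_of_set (edges \<tau>)"
    and "Dm \<inter> Dp = {}" "\<tau> \<in> Dm \<Longrightarrow> \<tau> \<in> S" "\<tau> \<in> Dp \<Longrightarrow> \<tau> \<notin> S"
    and S': "S' = (S - (Dm \<inter> {\<tau>})) \<union> (Dp \<inter> {\<tau>})"
  shows "fold (edit_edge Dm Dp \<tau>) xs (edge_mult S, rebuilt_matrix \<epsilon> S) =
    (edge_mult S', rebuilt_matrix \<epsilon> S')"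
proof -
  have xs: "distinct xs" "set xs = edges \<tau>"
    using assms(1) by (auto dest: permutations_of_setD)
  have mult: "edge_mult S' e =
      edge_mult S e + of_bool (e \<in> set xs) * (of_bool (\<tau> \<in> Dp) - of_bool (\<tau> \<in> Dm))" for e
  proof -
    consider "\<tau> \<in> Dm" "\<tau> \<notin> Dp" | "\<tau> \<notin> Dm" "\<tau> \<in> Dp" | "\<tau> \<notin> Dm" "\<tau> \<notin> Dp"
      using assms(2) by blast
    then show ?thesis
    proof cases
      case 1
      then show ?thesis
        using assms(3) edge_mult_remove[of \<tau> S e] by (simp add: S' xs)
    next
      case 2
      then show ?thesis
        \<comment> \<open>Addition is removal read backwards: since
          \<open>\<tau> \<notin> S\<close>, taking \<open>\<tau>\<close> out of
          \<open>insert \<tau> S\<close> gives \<open>S\<close> back.\<close>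
        using assms(4) edge_mult_remove[of \<tau> "insert \<tau> S" e] by (simp add: S' xs)
    qed (simp add: S')
  qed
  \<comment> \<open>The left-hand side is the multiplicity of \<open>e\<close> in \<open>S'\<close>,
    hence nonnegative.\<close>
  have "edge_mult S e + of_bool (\<tau> \<in> Dp) - of_bool (\<tau> \<in> Dm) \<ge> 0" if "e \<in> set xs" for e
    using edge_mult_nonneg[of S' e] mult[of e] that by simp
  then show ?thesis
    unfolding rebuilt_matrix_eq_counter_matrix
    by (intro fold_edit_edge_counter_matrix) (use xs mult in \<open>auto simp: card_edge edge_mult_nonneg\<close>)
qed

text \<open>Membership in \<open>S\<close> is only required of tetrahedra still in the list. In this
  form the hypotheses survive the induction: a visited element of \<open>Dm\<close> has left the
  active set, a visited element of \<open>Dp\<close> has joined it, and distinctness prevents a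
  second visit.\<close>

lemma process_frame_rebuilt_matrix:
  fixes S :: "'n::finite set set"
  assumes "distinct ts"
    and "\<And>\<tau>. \<tau> \<in> set ts \<Longrightarrow> es \<tau> \<in> permutations_of_set (edges \<tau>)"
    and "Dm \<inter> Dp = {}" "Dm \<inter> set ts \<subseteq> S" "Dp \<inter> set ts \<inter> S = {}"
    and "S' = (S - (Dm \<inter> set ts)) \<union> (Dp \<inter> set ts)"
  shows "process_frame Dm Dp ts es (edge_mult S, rebuilt_matrix \<epsilon> S) =
    (edge_mult S', rebuilt_matrix \<epsilon> S')"
  using assms
proof (induction ts arbitrary: S)
  case Nil
  then show ?case
    by (simp add: process_frame_def)
next
  case (Cons \<tau> ts)
  define R where "R = (S - (Dm \<inter> {\<tau>})) \<union> (Dp \<inter> {\<tau>})"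
  have "fold (edit_edge Dm Dp \<tau>) (es \<tau>) (edge_mult S, rebuilt_matrix \<epsilon> S) =
      (edge_mult R, rebuilt_matrix \<epsilon> R)"
    by (rule fold_edit_edge_rebuilt_matrix) (use Cons.prems in \<open>auto simp: R_def\<close>)
  moreover have "process_frame Dm Dp ts es (edge_mult R, rebuilt_matrix \<epsilon> R) =
      (edge_mult S', rebuilt_matrix \<epsilon> S')"
    by (rule Cons.IH) (use Cons.prems in \<open>auto simp: R_def\<close>)
  ultimately show ?case
    by (simp add: process_frame_def)
qed

theorem mainTheorem1:
  fixes C :: "'n::finite set set"
    and F :: nat
    and T Dm Dp :: "nat \<Rightarrow> 'n set set"
    and ts :: "nat \<Rightarrow> 'n set list"
    and es :: "nat \<Rightarrow> 'n set \<Rightarrow> 'n set list"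
    and \<epsilon> :: real
  assumes "finite C"
    and "\<And>\<tau>. \<tau> \<in> C \<Longrightarrow> tetrahedron \<tau>"
    and "T 0 \<subseteq> C"
    and "\<And>t. t < F \<Longrightarrow> Dm t \<subseteq> T t"
    and "\<And>t. t < F \<Longrightarrow> Dp t \<subseteq> C - T t"
    and "\<And>t. t < F \<Longrightarrow> T (Suc t) = (T t - Dm t) \<union> Dp t"
    and "\<epsilon> > 0"
    and "\<And>t. t < F \<Longrightarrow> ts t \<in> permutations_of_set (Dm t \<union> Dp t)"
    and "\<And>t \<tau>. t < F \<Longrightarrow> \<tau> \<in> Dm t \<union> Dp t \<Longrightarrow> es t \<tau> \<in> permutations_of_set (edges \<tau>)"
  shows "\<forall>t\<le>F. maintained_matrix \<epsilon> (T 0) Dm Dp ts es t = rebuilt_matrix \<epsilon> (T t)"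
proof -
  \<comment> \<open>The induction over frames must carry the counters as well, since they decide
    which matrix edits the next frame makes.\<close>
  have "stream_state \<epsilon> (T 0) Dm Dp ts es t = (edge_mult (T t), rebuilt_matrix \<epsilon> (T t))"
    if "t \<le> F" for t
    using that
  proof (induction t)
    case 0
    then show ?case
      by simp
  next
    case (Suc t)
    then have "t < F"
      by simp
    have ts: "distinct (ts t)" "set (ts t) = Dm t \<union> Dp t"
      using assms(8)[OF \<open>t < F\<close>] by (auto dest: permutations_of_setD)
    \<comment> \<open>The first two facts also make \<open>Dm t\<close> and \<open>Dp t\<close>
      disjoint: one lies inside \<open>T t\<close>, the other outside.\<close>
    note frame = assms(4-6)[OF \<open>t < F\<close>]
    have "process_frame (Dm t) (Dp t) (ts t) (es t) (edge_mult (T t), rebuilt_matrix \<epsilon> (T t)) =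
        (edge_mult (T (Suc t)), rebuilt_matrix \<epsilon> (T (Suc t)))"
    proof (rule process_frame_rebuilt_matrix)
      show "es t \<tau> \<in> permutations_of_set (edges \<tau>)" if "\<tau> \<in> set (ts t)" for \<tau>
        using assms(9)[OF \<open>t < F\<close>] that ts by simp
    qed (use ts frame in auto)
    then show ?case
      using Suc by simp
  qed
  then show ?thesis
    by (simp add: maintained_matrix_def)
qed

end
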